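(* For every even integer $d \ge 2$ and every $n \in \mathbb{N}^*$, the SONC cone $C_{n,d}$ is not closed under multiplication in the following sense: there exist $p_1,p_2 \in C_{n,d}$ such that $p_1\cdot p_2 \notin C_{n,2d}$.
   Context: $\mathbb{N}$ contains $0$ and $\mathbb{N}^* = \mathbb{N}\setminus\{0\}$. A circuit polynomial is a polynomial $f(\mathbf{x}) = \sum_{j=0}^r f_{\boldsymbol{\alpha}(j)} \mathbf{x}^{\boldsymbol{\alpha}(j)} + f_{\boldsymbol{\beta}} \mathbf{x}^{\boldsymbol{\beta}}$ in $\mathbb{R}[x_1,\dots,x_n]$ with $0\le r \le n$, exponents $\boldsymbol{\alpha}(j),\boldsymbol{\beta} \in \mathbb{N}^n$, $f_{\boldsymbol{\alpha}(j)} > 0$, $f_{\boldsymbol{\beta}} \in \mathbb{R}$, such that $\boldsymbol{\alpha}(0),\dots,\boldsymbol{\alpha}(r)$ lie in $(2\mathbb{N})^n$ and are affinely independent (so they are the vertices of a simplex), and $\boldsymbol{\beta}$ lies in the relative interior of that simplex. In particular, monomial squares $c\,\mathbf{x}^{\boldsymbol{\alpha}}$ with $c>0$ and $\boldsymbol{\alpha} \in (2\mathbb{N})^n$ count as (nonnegative) circuit polynomials. A circuit polynomial is nonnegative if it is nonnegative on all of $\mathbb{R}^n$. For even $D \ge 2$, $C_{n,D}$ is the set of SONC polynomials in $n$ variables of degree at most $D$: all $f=\sum_{i=1}^k \mu_i q_i$ of degree at most $D$ with $k\in\mathbb{N}^*$, $\mu_i \ge 0$ and $q_i$ nonnegative circuit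 polynomials. *)

theory Defs
  imports "HOL-Analysis.Analysis" "HOL-Library.Poly_Mapping"
begin

text \<open>
  Real polynomials in variables indexed by a finite type \<open>'n\<close>, so \<open>n = CARD('n)\<close>:
  finitely supported coefficient functions on \<open>\<nat>^n\<close>. The ring structure (in particular
  multiplication as convolution) is the one of \<^theory>\<open>HOL-Library.Poly_Mapping\<close>, and
  \<open>Poly_Mapping.single \<alpha> c\<close> is the monomial \<open>c x^\<alpha>\<close>.
\<close>
type_synonym 'n rpoly = "(nat ^ 'n) \<Rightarrow>\<^sub>0 real"

definition eval_poly :: "'n::finite rpoly \<Rightarrow> real ^ 'n \<Rightarrow> real" where
  "eval_poly f x =
     (\<Sum>\<alpha>\<in>Poly_Mapping.keys f. Poly_Mapping.lookup f \<alpha> * (\<Prod>i\<in>UNIV. x $ i ^ (\<alpha> $ i)))"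

text \<open>The zero polynomial gets total degree \<open>0\<close>.\<close>
definition total_degree :: "'n::finite rpoly \<Rightarrow> nat" where
  "total_degree f = Max (insert 0 ((\<lambda>\<alpha>. \<Sum>i\<in>UNIV. \<alpha> $ i) ` Poly_Mapping.keys f))"

definition real_exponent :: "nat ^ 'n \<Rightarrow> real ^ 'n" where
  "real_exponent \<alpha> = (\<chi> i. real (\<alpha> $ i))"

text \<open>
  \<^const>\<open>affine_dependent\<close> is a property of sets; affine independence of the family
  \<open>\<alpha> 0, \<dots>, \<alpha> r\<close> therefore also requires its members to be distinct. For \<open>r = 0\<close> the relative
  interior of the simplex is the point \<open>\<alpha> 0\<close> itself, so \<open>\<beta> = \<alpha> 0\<close>; with \<open>b = 0\<close> this
  covers the monomial squares.
\<close>
definition circuit_poly :: "'n::finite rpoly \<Rightarrow> bool" where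
  "circuit_poly f \<longleftrightarrow>
     (\<exists>(r::nat) (\<alpha> :: nat \<Rightarrow> nat ^ 'n) (a :: nat \<Rightarrow> real) (\<beta> :: nat ^ 'n) (b :: real).
        r \<le> CARD('n) \<and>
        (\<forall>j\<le>r. a j > 0) \<and>
        (\<forall>j\<le>r. \<forall>i. even (\<alpha> j $ i)) \<and>
        inj_on \<alpha> {..r} \<and>
        \<not> affine_dependent ((\<lambda>j. real_exponent (\<alpha> j)) ` {..r}) \<and>
        real_exponent \<beta> \<in> rel_interior (convex hull ((\<lambda>j. real_exponent (\<alpha> j)) ` {..r})) \<and>
        f = (\<Sum>j\<le>r. Poly_Mapping.single (\<alpha> j) (a j)) + Poly_Mapping.single \<beta> b)"

definition nonneg_circuit_poly :: "'n::finite rpoly \<Rightarrow> bool" where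
  "nonneg_circuit_poly f \<longleftrightarrow> circuit_poly f \<and> (\<forall>x. eval_poly f x \<ge> 0)"

text \<open>
  The cone \<open>C\<^bsub>n,D\<^esub>\<close> for \<open>n = CARD('n)\<close>. Scaling by \<open>\<mu> i\<close> is written as multiplication by
  the constant polynomial \<open>Poly_Mapping.single 0 (\<mu> i)\<close>.
\<close>
definition sonc_cone :: "nat \<Rightarrow> 'n::finite rpoly set" where
  "sonc_cone D =
     {f. total_degree f \<le> D \<and>
         (\<exists>(k::nat) (\<mu> :: nat \<Rightarrow> real) (q :: nat \<Rightarrow> 'n rpoly).
            k \<ge> 1 \<and>
            (\<forall>i\<in>{1..k}. \<mu> i \<ge> 0 \<and> nonneg_circuit_poly (q i)) \<and>
            f = (\<Sum>i=1..k. Poly_Mapping.single 0 (\<mu> i) * q i))}"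

end

theory Submission imports Defs begin

text \<open>
  In logarithmic coordinates on the open positive orthant a circuit polynomial, divided by its
  inner monomial \<open>x^\<beta>\<close>, is a positive combination of exponentials plus a constant, hence convex.
  So a nonnegative circuit polynomial that vanishes at two positive points \<open>x\<close>, \<open>y\<close> is also
  \<open>\<le> 0\<close> at their componentwise geometric mean. If a SONC polynomial vanishes at \<open>x\<close> and \<open>y\<close>,
  so does every summand with positive weight; hence the sum is \<open>\<le> 0\<close> at the geometric mean as
  well. The product of the circuit polynomials \<open>(x\<^sub>k - 1)\<^sup>2\<close> and \<open>(x\<^sub>k - 4)\<^sup>2\<close> violates this,
  since it vanishes for \<open>x\<^sub>k = 1\<close> and \<open>x\<^sub>k = 4\<close> but equals \<open>4\<close> for \<open>x\<^sub>k = 2\<close>.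
\<close>

definition eval_monom :: "nat ^ 'n \<Rightarrow> real ^ 'n \<Rightarrow> real" where
  "eval_monom \<alpha> x = (\<Prod>i\<in>UNIV. x $ i ^ (\<alpha> $ i))"

lemma eval_monom_0 [simp]: "eval_monom 0 x = 1"
  by (simp add: eval_monom_def)

lemma eval_monom_axis [simp]: "eval_monom (axis k m) x = x $ k ^ m"
proof -
  have "eval_monom (axis k m) x = (\<Prod>i\<in>UNIV. if i = k then x $ k ^ m else 1)"
    unfolding eval_monom_def by (rule prod.cong) (auto simp: axis_def)
  then show ?thesis by simp
qed

lemma eval_monom_add: "eval_monom (\<alpha> + \<beta>) x = eval_monom \<alpha> x * eval_monom \<beta> x"
  by (simp add: eval_monom_def power_add prod.distrib)

lemma eval_monom_pos: "(\<And>i. x $ i > 0) \<Longrightarrow> eval_monom \<alpha> x > 0"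
  by (simp add: eval_monom_def prod_pos)

text \<open>Monomials are multiplicative in the point, so they commute with the componentwise
  geometric mean. Describing \<open>z\<close> through its squares avoids square roots.\<close>

lemma eval_monom_geometric_mean:
  assumes "\<And>i. (z $ i)\<^sup>2 = x $ i * y $ i"
  shows "(eval_monom \<alpha> z)\<^sup>2 = eval_monom \<alpha> x * eval_monom \<alpha> y"
proof -
  have "(eval_monom \<alpha> z)\<^sup>2 = (\<Prod>i\<in>UNIV. ((z $ i)\<^sup>2) ^ (\<alpha> $ i))"
    by (simp add: eval_monom_def prod_power_distrib mult.commute flip: power_mult)
  then show ?thesis
    by (simp add: assms eval_monom_def power_mult_distrib prod.distrib)
qed

text \<open>Exponents outside the support contribute 0. This allows several polynomials to be
  evaluated over one common index set, as additivity requires.\<close>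

lemma eval_poly_superset:
  assumes "finite A" "Poly_Mapping.keys f \<subseteq> A"
  shows "eval_poly f x = (\<Sum>\<alpha>\<in>A. Poly_Mapping.lookup f \<alpha> * eval_monom \<alpha> x)"
  unfolding eval_poly_def eval_monom_def
  using assms by (intro sum.mono_neutral_left) (auto simp: in_keys_iff)

lemma eval_poly_single [simp]: "eval_poly (Poly_Mapping.single \<alpha> c) x = c * eval_monom \<alpha> x"
  by (subst eval_poly_superset[of "{\<alpha>}"]) auto

lemma eval_poly_add [simp]: "eval_poly (f + g) x = eval_poly f x + eval_poly g x"
proof -
  let ?A = "Poly_Mapping.keys f \<union> Poly_Mapping.keys g"
  have "eval_poly h x = (\<Sum>\<alpha>\<in>?A. Poly_Mapping.lookup h \<alpha> * eval_monom \<alpha> x)"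
    if "h \<in> {f, g, f + g}" for h
    using that Poly_Mapping.keys_add[of f g] by (intro eval_poly_superset) auto
  then show ?thesis by (simp add: lookup_add distrib_right sum.distrib)
qed

lemma eval_poly_0 [simp]: "eval_poly 0 x = 0"
  by (simp add: eval_poly_def)

lemma eval_poly_sum [simp]: "eval_poly (\<Sum>i\<in>I. f i) x = (\<Sum>i\<in>I. eval_poly (f i) x)"
  by (induction I rule: infinite_finite_induct) auto

text \<open>Reduces products of polynomials to products of monomials by bilinearity.\<close>

lemma poly_mapping_sum_singles:
  "f = (\<Sum>\<alpha>\<in>Poly_Mapping.keys f. Poly_Mapping.single \<alpha> (Poly_Mapping.lookup f \<alpha>))"
  by (rule poly_mapping_eqI)
     (simp add: lookup_sum lookup_single when_def in_keys_iff)

lemma eval_poly_mult [simp]: "eval_poly (f * g) x = eval_poly f x * eval_poly g x"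
proof -
  have "f * g = (\<Sum>\<alpha>\<in>Poly_Mapping.keys f. \<Sum>\<beta>\<in>Poly_Mapping.keys g.
      Poly_Mapping.single (\<alpha> + \<beta>) (Poly_Mapping.lookup f \<alpha> * Poly_Mapping.lookup g \<beta>))"
    by (subst poly_mapping_sum_singles[of f], subst poly_mapping_sum_singles[of g])
       (simp add: sum_product mult_single)
  then have "eval_poly (f * g) x = (\<Sum>\<alpha>\<in>Poly_Mapping.keys f. \<Sum>\<beta>\<in>Poly_Mapping.keys g.
      Poly_Mapping.lookup f \<alpha> * eval_monom \<alpha> x * (Poly_Mapping.lookup g \<beta> * eval_monom \<beta> x))"
    by (simp add: eval_monom_add mult_ac)
  then show ?thesis
    by (simp add: eval_poly_superset[OF finite_keys order_refl] sum_product)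
qed

lemma circuit_poly_geometric_mean:
  fixes q :: "'n::finite rpoly"
  assumes q: "circuit_poly q"
    and x: "\<And>i. x $ i > 0" and y: "\<And>i. y $ i > 0" and z: "\<And>i. z $ i > 0"
    and mean: "\<And>i. (z $ i)\<^sup>2 = x $ i * y $ i"
    and "eval_poly q x = 0" "eval_poly q y = 0"
  shows "eval_poly q z \<le> 0"
proof -
  obtain r :: nat and \<alpha> :: "nat \<Rightarrow> nat ^ 'n" and a \<beta> b where a: "\<And>j. j \<le> r \<Longrightarrow> a j > 0"
    and q_eq: "q = (\<Sum>j\<le>r. Poly_Mapping.single (\<alpha> j) (a j)) + Poly_Mapping.single \<beta> b"
    using q unfolding circuit_poly_def by blast
  \<comment> \<open>Dividing by the inner monomial turns the only term of unknown sign into the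
    constant \<open>b\<close>; the remaining weights \<open>a j\<close> are positive.\<close>
  define R where "R w j = eval_monom (\<alpha> j) w / eval_monom \<beta> w" for w j
  have eval: "eval_poly q w = eval_monom \<beta> w * ((\<Sum>j\<le>r. a j * R w j) + b)"
    if "\<And>i. w $ i > 0" for w
    using eval_monom_pos[of w \<beta>, OF that]
    by (simp add: q_eq R_def distrib_left sum_distrib_left mult.commute)
  have zero: "(\<Sum>j\<le>r. a j * R w j) = - b" if "eval_poly q w = 0" "\<And>i. w $ i > 0" for w
    using eval[of w, OF that(2)] eval_monom_pos[of w \<beta>, OF that(2)] that(1) by simp
  \<comment> \<open>AM-GM: \<open>R z j\<close> is the geometric mean of \<open>R x j\<close> and
    \<open>R y j\<close>. After squaring, the claim is (s + t)^2 - 4 s t = (s - t)^2 \<ge>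
    0.\<close>
  have R: "2 * R z j \<le> R x j + R y j" for j
  proof (rule power2_le_imp_le)
    have "(R z j)\<^sup>2 = R x j * R y j"
      by (simp add: R_def power_divide eval_monom_geometric_mean[OF mean])
    then show "(2 * R z j)\<^sup>2 \<le> (R x j + R y j)\<^sup>2"
      using zero_le_power2[of "R x j - R y j"] by (simp add: power2_eq_square algebra_simps)
    show "0 \<le> R x j + R y j"
      unfolding R_def using x y by (intro add_nonneg_nonneg divide_nonneg_pos)
        (auto intro: eval_monom_pos less_imp_le)
  qed
  have "2 * (\<Sum>j\<le>r. a j * R z j) = (\<Sum>j\<le>r. a j * (2 * R z j))"
    by (simp add: sum_distrib_left mult_ac)
  also have "\<dots> \<le> (\<Sum>j\<le>r. a j * (R x j + R y j))"
    using R a by (intro sum_mono mult_left_mono) (auto intro: less_imp_le)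
  also have "\<dots> = - b + - b"
    using zero[of x] zero[of y] assms by (simp add: distrib_left sum.distrib)
  finally have "(\<Sum>j\<le>r. a j * R z j) + b \<le> 0" by simp
  then show ?thesis
    using eval[of z] eval_monom_pos[of z \<beta>] z by (simp add: mult_nonneg_nonpos)
qed

lemma sonc_cone_geometric_mean:
  fixes f :: "'n::finite rpoly"
  assumes f: "f \<in> sonc_cone D"
    and pos: "\<And>i. x $ i > 0" "\<And>i. y $ i > 0" "\<And>i. z $ i > 0"
    and mean: "\<And>i. (z $ i)\<^sup>2 = x $ i * y $ i"
    and zeros: "eval_poly f x = 0" "eval_poly f y = 0"
  shows "eval_poly f z \<le> 0"
proof -
  obtain k :: nat and \<mu> and q :: "nat \<Rightarrow> 'n rpoly"
    where \<mu>: "\<And>i. i \<in> {1..k} \<Longrightarrow> \<mu> i \<ge> 0"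
      and q: "\<And>i. i \<in> {1..k} \<Longrightarrow> nonneg_circuit_poly (q i)"
      and f_eq: "f = (\<Sum>i=1..k. Poly_Mapping.single 0 (\<mu> i) * q i)"
    using f unfolding sonc_cone_def by blast
  have eval: "eval_poly f w = (\<Sum>i=1..k. \<mu> i * eval_poly (q i) w)" for w
    by (simp add: f_eq)
  \<comment> \<open>Nonnegative summands cannot cancel, so each of them vanishes wherever
    \<open>f\<close> does.\<close>
  have zero: "\<mu> i * eval_poly (q i) w = 0" if "eval_poly f w = 0" "i \<in> {1..k}" for w i
  proof -
    have "\<And>j. j \<in> {1..k} \<Longrightarrow> \<mu> j * eval_poly (q j) w \<ge> 0"
      using \<mu> q by (auto simp: nonneg_circuit_poly_def)
    then show ?thesis
      using that eval[of w] sum_nonneg_eq_0_iff[of "{1..k}" "\<lambda>i. \<mu> i * eval_poly (q i) w"]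
      by auto
  qed
  have "\<mu> i * eval_poly (q i) z \<le> 0" if i: "i \<in> {1..k}" for i
  \<comment> \<open>A summand of weight 0 may be nonzero at \<open>x\<close> and \<open>y\<close>,
    but it contributes nothing at \<open>z\<close> either.\<close>
  proof (cases "\<mu> i = 0")
    case False
    then have "eval_poly (q i) x = 0" "eval_poly (q i) y = 0"
      using zero zeros i by (metis mult_eq_0_iff)+
    then have "eval_poly (q i) z \<le> 0"
      using circuit_poly_geometric_mean[of "q i" x y z] q[OF i] pos mean
      by (simp add: nonneg_circuit_poly_def)
    then show ?thesis using \<mu>[OF i] by (simp add: mult_nonneg_nonpos)
  qed simp
  then show ?thesis unfolding eval by (rule sum_nonpos)
qed

text \<open>The square of x_k - c, expanded so that the circuit shape is visible: outer exponents 0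
  and 2 e_k, inner exponent e_k.\<close>

definition shifted_square :: "'n::finite \<Rightarrow> real \<Rightarrow> 'n rpoly" where
  "shifted_square k c = Poly_Mapping.single 0 (c\<^sup>2) + Poly_Mapping.single (axis k 2) 1
     + Poly_Mapping.single (axis k 1) (- 2 * c)"

lemma eval_shifted_square: "eval_poly (shifted_square k c) x = (x $ k - c)\<^sup>2"
  by (simp add: shifted_square_def power2_eq_square algebra_simps)

lemma real_exponent_axis: "real_exponent (axis k m) = axis k (real m)"
  by (simp add: real_exponent_def axis_def vec_eq_iff)

lemma circuit_poly_shifted_square:
  fixes k :: "'n::finite"
  assumes "c > 0"
  shows "circuit_poly (shifted_square k c)"
proof -
  define \<alpha> :: "nat \<Rightarrow> nat ^ 'n" where "\<alpha> j = axis k (2 * j)" for j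
  define a where "a j = (if j = 0 then c\<^sup>2 else 1)" for j :: nat
  \<comment> \<open>Stated with \<open>Suc 0\<close> because the simplifier rewrites 1 to that
    form.\<close>
  have two: "{..Suc 0} = {0, Suc 0}" by auto
  have axis_0: "axis k 0 = (0 :: 'b::zero ^ 'n)" by (simp add: axis_def vec_eq_iff)
  have axis_2: "axis k 2 \<noteq> (0 :: real ^ 'n)" by (simp add: axis_eq_0_iff)
  have image: "(\<lambda>j. real_exponent (\<alpha> j)) ` {..1} = {0, axis k 2}"
    by (simp add: two \<alpha>_def real_exponent_axis axis_0)
  \<comment> \<open>The inner exponent is the midpoint of the segment, hence the witness 1/2; for
    distinct endpoints the relative interior of the segment is the open segment.\<close>
  have "axis k 1 \<in> open_segment 0 (axis k 2 :: real ^ 'n)"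
    using axis_2 by (auto simp: in_segment vec_eq_iff axis_def intro!: exI[of _ "1/2"])
  then have "axis k 1 \<in> rel_interior (convex hull {0, axis k 2 :: real ^ 'n})"
    using axis_2 by (simp add: rel_interior_closed_segment flip: segment_convex_hull)
  then have interior: "real_exponent (axis k 1)
      \<in> rel_interior (convex hull ((\<lambda>j. real_exponent (\<alpha> j)) ` {..1}))"
    by (simp only: image real_exponent_axis of_nat_1)
  have "shifted_square k c = (\<Sum>j\<le>1. Poly_Mapping.single (\<alpha> j) (a j))
      + Poly_Mapping.single (axis k 1) (- 2 * c)"
    by (simp add: shifted_square_def two \<alpha>_def a_def axis_0)
  moreover have "inj_on \<alpha> {..1}"
    by (auto simp: inj_on_def \<alpha>_def axis_eq_axis)
  moreover have "\<forall>j\<le>1. \<forall>i. even (\<alpha> j $ i)"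
    by (simp add: \<alpha>_def axis_def)
  moreover have "\<forall>j\<le>1. a j > 0"
    using assms by (simp add: a_def)
  moreover have "\<not> affine_dependent ((\<lambda>j. real_exponent (\<alpha> j)) ` {..1})"
    \<comment> \<open>Two points are always affinely independent. Unfolding 1 to
      \<open>Suc 0\<close> would keep \<open>image\<close> from matching.\<close>
    by (simp add: image del: One_nat_def)
  moreover have "1 \<le> CARD('n)"
    by (simp add: Suc_le_eq)
  ultimately show ?thesis
    unfolding circuit_poly_def using interior by blast
qed

lemma total_degree_shifted_square: "total_degree (shifted_square k c) \<le> 2"
proof -
  have "(\<Sum>i\<in>UNIV. axis k m $ i) = m" for m :: nat
    by (simp add: axis_def)
  moreover have "Poly_Mapping.keys (shifted_square k c) \<subseteq> {0, axis k 2, axis k 1}"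
    unfolding shifted_square_def
    by (rule order_trans[OF Poly_Mapping.keys_add] Un_least)+ auto
  ultimately show ?thesis
    unfolding total_degree_def by (subst Max_le_iff) (auto dest!: subsetD)
qed

lemma shifted_square_in_sonc_cone:
  assumes "c > 0" "d \<ge> 2"
  shows "shifted_square k c \<in> sonc_cone d"
proof -
  have "nonneg_circuit_poly (shifted_square k c)"
    by (simp add: nonneg_circuit_poly_def circuit_poly_shifted_square assms eval_shifted_square)
  then show ?thesis
    unfolding sonc_cone_def
    using order_trans[OF total_degree_shifted_square assms(2)]
    by (auto intro!: exI[of _ "1::nat"] exI[of _ "\<lambda>_. 1::real"] exI[of _ "\<lambda>_. shifted_square k c"])
qed

theorem lemma3p1:
  fixes d :: nat
  assumes "even d" and "d \<ge> 2"
  shows "\<exists>p1 p2 :: 'n::finite rpoly.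
           p1 \<in> sonc_cone d \<and> p2 \<in> sonc_cone d \<and> p1 * p2 \<notin> sonc_cone (2 * d)"
proof -
  \<comment> \<open>Any one variable suffices, which covers every n \<ge> 1 at once.\<close>
  fix k :: 'n
  let ?f = "shifted_square k 1 * shifted_square k 4"
  have "?f \<notin> sonc_cone (2 * d)"
  proof
    assume "?f \<in> sonc_cone (2 * d)"
    then have "eval_poly ?f (\<chi> i. 2) \<le> 0"
      \<comment> \<open>Constant vectors make every coordinate positive and satisfy 2^2 = 1 * 4 in
        each of them, not only in coordinate \<open>k\<close>.\<close>
      by (rule sonc_cone_geometric_mean[where x = "\<chi> i. 1" and y = "\<chi> i. 4"])
         (simp_all add: eval_shifted_square)
    then show False by (simp add: eval_shifted_square)
  qed
  then show ?thesis
    using shifted_square_in_sonc_cone[of _ d k] assms(2) by (meson zero_less_one zero_less_numeral)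
qed

end
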